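(* For an instance of the Capacitated Facility Location Problem with Customer Preferences (CFLCP) with customers $I$, plants $J$, capacities $c_j$, opening costs $f_j$, allocation costs $g_{ij}$ and strict rankings $\prec_i$, identify $J$ with $\{1,\dots,|J|\}$ when used as the index set of the superscript $r$, and consider the model $$\min_{y,x,u}\ \sum_{j\in J} f_j y_j+\sum_{i\in I}\sum_{j\in J} g_{ij}x_{ij}$$ subject to $$\sum_{j\in J}x_{ij}=1\quad \forall i\in I,$$ $$x_{ij}\le y_j\quad \forall i\in I,\ j\in J,$$ $$\sum_{r\in J}u_j^r\le y_j\quad \forall j\in J,$$ $$\sum_{j\in J}u_j^1\le 1,$$ $$\sum_{j\in J}u_j^r\le \sum_{j\in J}u_j^{r-1}\quad \forall r\in J,\ r>1,$$ $$\sum_{i\in I}x_{ij}\le (c_j-1)y_j+\sum_{r\in J}u_j^r\quad \forall j\in J,$$ $$c_j\sum_{r\in J}u_j^r\le \sum_{i\in I}x_{ij}\quad \forall j\in J,$$ $$x_{ij}+\sum_{r'=1}^{r-1}u_j^{r'}+\sum_{j'\in J:\, j'\prec_i j}u_{j'}^r\le 1+y_j\quad \forall i\in I,\ j,r\in J,$$ $$y_j-\sum_{r\in J}u_j^r\le \sum_{j'\in J:\, j'\preceq_i j}x_{ij'}\quad \forall i\in I,\ j\in J,$$ $$x_{ij}\in\{0,1\}\quad \forall i\in I,\ j\in J,\qquad y_j,u_j^r\in\{0,1\}\quad \forall j,r\in J.$$ The integrality constraints on the $x$-variables can be relaxed in this model: for every instance, the model obtained by replacing $x_{ij}\in\{0,1\}$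 with $0\le x_{ij}\le 1$ for all $i\in I$, $j\in J$ (keeping $y_j,u_j^r\in\{0,1\}$) is feasible if and only if the original model is feasible, and in that case the two models have the same optimal value.
   Context: An instance of CFLCP consists of a finite set $J$ of potential plants, a finite set $I$ of customers, for each plant $j\in J$ an opening cost $f_j$ and a capacity $c_j$ (a positive integer, the maximum number of customers that can be allocated to $j$), for each pair $(i,j)\in I\times J$ an allocation cost $g_{ij}$, and for each customer $i\in I$ a strict total order $\prec_i$ on $J$, where $j\prec_i j'$ means that $i$ prefers $j$ to $j'$. One writes $j\preceq_i j'$ if $j\prec_i j'$ or $j=j'$. It is assumed that $c_j<|I|$ for at least one $j\in J$. In the model, $y_j=1$ means plant $j$ is open, $x_{ij}=1$ means customer $i$ is allocated to plant $j$, and $u_j^r=1$ means plant $j$ is the $r$-th plant to fill up. *)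

theory Defs
  imports Complex_Main
begin

text \<open>
  An instance of the capacitated facility location problem with customer preferences.
  \<open>(j, j') \<in> pref P i\<close> stands for \<open>j \<prec>\<^sub>i j'\<close>: customer \<open>i\<close> prefers \<open>j\<close> to \<open>j'\<close>.
\<close>

record ('i, 'j) cflcp =
  customers :: "'i set"
  plants :: "'j set"
  open_cost :: "'j \<Rightarrow> real"
  capacity :: "'j \<Rightarrow> nat"
  alloc_cost :: "'i \<Rightarrow> 'j \<Rightarrow> real"
  pref :: "'i \<Rightarrow> ('j \<times> 'j) set"

definition cflcp_instance :: "('i, 'j) cflcp \<Rightarrow> bool" where
  "cflcp_instance P \<longleftrightarrow>
     finite (customers P) \<and> finite (plants P) \<and>
     (\<forall>j\<in>plants P. capacity P j > 0) \<and>
     (\<forall>i\<in>customers P. pref P i \<subseteq> plants P \<times> plants P \<and>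
        strict_linear_order_on (plants P) (pref P i)) \<and>
     (\<exists>j\<in>plants P. capacity P j < card (customers P))"

text \<open>
  A solution is a triple \<open>(y, x, u)\<close>, where \<open>u j r\<close> stands for \<open>u\<^sub>j\<^sup>r\<close>.  The rank \<open>r\<close> ranges over
  \<open>ranks P\<close>, which takes the place of \<open>J\<close> as index set of the superscript.
\<close>

type_synonym ('i, 'j) cflcp_sol = "('j \<Rightarrow> real) \<times> ('i \<Rightarrow> 'j \<Rightarrow> real) \<times> ('j \<Rightarrow> nat \<Rightarrow> real)"

definition ranks :: "('i, 'j) cflcp \<Rightarrow> nat set" where
  "ranks P = {1..card (plants P)}"

definition cost :: "('i, 'j) cflcp \<Rightarrow> ('i, 'j) cflcp_sol \<Rightarrow> real" where
  "cost P = (\<lambda>(y, x, u).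
     (\<Sum>j\<in>plants P. open_cost P j * y j) +
     (\<Sum>i\<in>customers P. \<Sum>j\<in>plants P. alloc_cost P i j * x i j))"

definition linear_constraints :: "('i, 'j) cflcp \<Rightarrow> ('i, 'j) cflcp_sol \<Rightarrow> bool" where
  "linear_constraints P = (\<lambda>(y, x, u).
     (\<forall>i\<in>customers P. (\<Sum>j\<in>plants P. x i j) = 1) \<and>
     (\<forall>i\<in>customers P. \<forall>j\<in>plants P. x i j \<le> y j) \<and>
     (\<forall>j\<in>plants P. (\<Sum>r\<in>ranks P. u j r) \<le> y j) \<and>
     (\<Sum>j\<in>plants P. u j 1) \<le> 1 \<and>
     (\<forall>r\<in>ranks P. r > 1 \<longrightarrow> (\<Sum>j\<in>plants P. u j r) \<le> (\<Sum>j\<in>plants P. u j (r - 1))) \<and>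
     (\<forall>j\<in>plants P. (\<Sum>i\<in>customers P. x i j)
        \<le> (real (capacity P j) - 1) * y j + (\<Sum>r\<in>ranks P. u j r)) \<and>
     (\<forall>j\<in>plants P. real (capacity P j) * (\<Sum>r\<in>ranks P. u j r) \<le> (\<Sum>i\<in>customers P. x i j)) \<and>
     (\<forall>i\<in>customers P. \<forall>j\<in>plants P. \<forall>r\<in>ranks P.
        x i j + (\<Sum>r'\<in>{1..<r}. u j r') + (\<Sum>j'\<in>{j'\<in>plants P. (j', j) \<in> pref P i}. u j' r)
        \<le> 1 + y j) \<and>
     (\<forall>i\<in>customers P. \<forall>j\<in>plants P.
        y j - (\<Sum>r\<in>ranks P. u j r)
        \<le> (\<Sum>j'\<in>{j'\<in>plants P. (j', j) \<in> pref P i \<or> j' = j}. x i j')))"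

definition binary_yu :: "('i, 'j) cflcp \<Rightarrow> ('i, 'j) cflcp_sol \<Rightarrow> bool" where
  "binary_yu P = (\<lambda>(y, x, u). \<forall>j\<in>plants P. y j \<in> {0, 1} \<and> (\<forall>r\<in>ranks P. u j r \<in> {0, 1}))"

definition model_feasible :: "('i, 'j) cflcp \<Rightarrow> ('i, 'j) cflcp_sol set" where
  "model_feasible P = {(y, x, u). linear_constraints P (y, x, u) \<and> binary_yu P (y, x, u) \<and>
     (\<forall>i\<in>customers P. \<forall>j\<in>plants P. x i j \<in> {0, 1})}"

definition relaxed_feasible :: "('i, 'j) cflcp \<Rightarrow> ('i, 'j) cflcp_sol set" where
  "relaxed_feasible P = {(y, x, u). linear_constraints P (y, x, u) \<and> binary_yu P (y, x, u) \<and>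
     (\<forall>i\<in>customers P. \<forall>j\<in>plants P. 0 \<le> x i j \<and> x i j \<le> 1)}"

text \<open>The optimal value is an attained minimum, not merely an infimum.\<close>

definition is_optimal_value :: "('s \<Rightarrow> real) \<Rightarrow> 's set \<Rightarrow> real \<Rightarrow> bool" where
  "is_optimal_value obj F v \<longleftrightarrow> v \<in> obj ` F \<and> (\<forall>s\<in>F. v \<le> obj s)"

end

theory Submission imports Defs begin

text \<open>
  For fixed binary \<open>y\<close> and \<open>u\<close> the constraints on \<open>x\<close> amount to an assignment problem with
  integral bounds on the column sums and some entries forced to be 0: an open plant that is not
  full excludes all plants which a customer ranks below it.  A fractional solution is rounded by
  moving repeatedly along a nonzero direction that is supported on the fractional entries, preserves
  all row and column sums and does not increase the cost, until a further entry becomes integral.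
  Such a direction exists because every row or column with a fractional entry has at least two.
\<close>

section \<open>Homogeneous linear systems\<close>

text \<open>Gaussian elimination, by induction on the equations. An equation whose coefficients all
  vanish is dropped; any other one eliminates an unknown, so the surplus of unknowns over equations
  persists.\<close>

lemma homogeneous_system_nontrivial_solution:
  fixes a :: "'e \<Rightarrow> 'f \<Rightarrow> 'k :: field"
  assumes "finite E" "finite F" "card E < card F"
  shows "\<exists>d. (\<exists>f\<in>F. d f \<noteq> 0) \<and> (\<forall>e\<in>E. (\<Sum>f\<in>F. a e f * d f) = 0)"
  using assms
proof (induction E arbitrary: F a rule: finite_induct)
  case empty
  then have "F \<noteq> {}" by auto
  then show ?case by (intro exI[of _ "\<lambda>_. 1"]) auto
next
  case (insert e E)
  show ?case
  proof (cases "\<forall>f\<in>F. a e f = 0")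
    case True
    moreover obtain d where "\<exists>f\<in>F. d f \<noteq> 0" "\<forall>e'\<in>E. (\<Sum>f\<in>F. a e' f * d f) = 0"
      using insert.IH[of F a] insert.prems insert.hyps by auto
    ultimately show ?thesis by (intro exI[of _ d]) auto
  next
    case False
    then obtain f0 where f0: "f0 \<in> F" "a e f0 \<noteq> 0" by blast
    define G where "G = F - {f0}"
    \<comment> \<open>\<open>b\<close> is the system that remains after eliminating the pivot
      unknown \<open>f0\<close> by means of equation \<open>e\<close>.\<close>
    define b where "b = (\<lambda>e' f. a e' f - a e' f0 / a e f0 * a e f)"
    have "finite G" "card E < card G"
      using insert.prems insert.hyps f0 by (auto simp: G_def)
    then obtain d where d: "\<exists>f\<in>G. d f \<noteq> 0" "\<forall>e'\<in>E. (\<Sum>f\<in>G. b e' f * d f) = 0"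
      using insert.IH[of G b] by blast
    \<comment> \<open>Back substitution: \<open>c\<close> is the value that equation
      \<open>e\<close> forces on \<open>f0\<close> once the other unknowns are given by
      \<open>d\<close>.\<close>
    define c where "c = - (\<Sum>f\<in>G. a e f * d f) / a e f0"
    have split: "(\<Sum>f\<in>F. a e' f * (d(f0 := c)) f) = a e' f0 * c + (\<Sum>f\<in>G. a e' f * d f)" for e'
    proof -
      have "(\<Sum>f\<in>G. a e' f * (d(f0 := c)) f) = (\<Sum>f\<in>G. a e' f * d f)"
        by (rule sum.cong) (auto simp: G_def)
      then show ?thesis
        using sum.remove[OF insert.prems(1) f0(1), of "\<lambda>f. a e' f * (d(f0 := c)) f"]
        by (simp add: G_def)
    qed
    have "(\<Sum>f\<in>F. a e' f * (d(f0 := c)) f) = 0" if "e' \<in> E" for e'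
    proof -
      have "0 = (\<Sum>f\<in>G. a e' f * d f) - a e' f0 / a e f0 * (\<Sum>f\<in>G. a e f * d f)"
        using d(2) that by (simp add: b_def algebra_simps sum_subtractf sum_distrib_left)
      then show ?thesis unfolding split by (simp add: c_def)
    qed
    moreover have "(\<Sum>f\<in>F. a e f * (d(f0 := c)) f) = 0"
      unfolding split using f0 by (simp add: c_def)
    moreover have "\<exists>f\<in>F. (d(f0 := c)) f \<noteq> 0"
      using d(1) by (auto simp: G_def)
    ultimately show ?thesis by blast
  qed
qed

section \<open>Circulations on the fractional entries of a matrix\<close>

text \<open>A lone fractional entry would be the integral total minus the other entries, which are
  integral, and hence would be integral itself.\<close>

lemma card_fractional_ge_2:
  fixes h :: "'a \<Rightarrow> real"
  assumes "finite A" and bounds: "\<And>a. a \<in> A \<Longrightarrow> 0 \<le> h a \<and> h a \<le> 1"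
    and int: "sum h A \<in> \<int>" and ne: "{a\<in>A. h a \<notin> \<int>} \<noteq> {}"
  shows "2 \<le> card {a\<in>A. h a \<notin> \<int>}"
proof (rule ccontr)
  assume "\<not> ?thesis"
  moreover have "card {a\<in>A. h a \<notin> \<int>} \<noteq> 0" using assms by auto
  ultimately have "card {a\<in>A. h a \<notin> \<int>} = 1" by linarith
  then obtain b where b: "{a\<in>A. h a \<notin> \<int>} = {b}" by (auto simp: card_1_singleton_iff)
  have "h b = sum h A - sum h (A - {b})"
    using b \<open>finite A\<close> by (subst sum.remove[of A b]) auto
  moreover have "sum h (A - {b}) \<in> \<int>" using b by (intro Ints_sum) auto
  ultimately have "h b \<in> \<int>" using int by simp
  then show False using b by auto
qed

text \<open>Add up the sizes of the fibres. With \<open>p\<close> a projection of matrix positions,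
  this bounds the number of rows, or of columns, that meet \<open>F\<close> by half the size of
  \<open>F\<close>.\<close>

lemma card_ge_twice_card_image:
  assumes "finite F" and "\<And>v. v \<in> p ` F \<Longrightarrow> 2 \<le> card {f\<in>F. p f = v}"
  shows "2 * card (p ` F) \<le> card F"
proof -
  have "2 * card (p ` F) = (\<Sum>v\<in>p ` F. 2)" by simp
  also have "\<dots> \<le> (\<Sum>v\<in>p ` F. card {f\<in>F. p f = v})" using assms by (intro sum_mono) auto
  also have "\<dots> = card F" using sum.image_gen[OF assms(1), of "\<lambda>_. 1::nat" p] by simp
  finally show ?thesis .
qed

lemma unit_interval_Ints_iff: "0 \<le> a \<Longrightarrow> a \<le> 1 \<Longrightarrow> a \<in> \<int> \<longleftrightarrow> a = 0 \<or> a = (1::real)"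
proof
  assume "0 \<le> a" "a \<le> 1" "a \<in> \<int>"
  then obtain k where "a = of_int k" by (auto elim: Ints_cases)
  with \<open>0 \<le> a\<close> \<open>a \<le> 1\<close> have "k = 0 \<or> k = 1" by auto
  then show "a = 0 \<or> a = 1" using \<open>a = of_int k\<close> by auto
qed auto

text \<open>The unknowns are the fractional entries, the equations are the rows in \<open>R\<close>
  and columns in \<open>C\<close> that contain one. Since each of these holds at least two, there
  are no more equations than unknowns, and omitting one redundant equation leaves strictly
  fewer.\<close>

lemma fractional_circulation:
  fixes x :: "'i \<Rightarrow> 'j \<Rightarrow> real"
  assumes fin: "finite I" "finite J"
    and bounds: "\<And>i j. i \<in> I \<Longrightarrow> j \<in> J \<Longrightarrow> 0 \<le> x i j \<and> x i j \<le> 1"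
    and rows: "\<And>i. i \<in> I \<Longrightarrow> (\<Sum>j\<in>J. x i j) \<in> \<int>"
    and cols: "\<And>j. j \<in> J \<Longrightarrow> (\<Sum>i\<in>I. x i j) \<in> \<int>"
    and frac: "i0 \<in> I" "j0 \<in> J" "x i0 j0 \<notin> \<int>"
  shows "\<exists>d. (\<exists>i\<in>I. \<exists>j\<in>J. d i j \<noteq> (0::real)) \<and>
    (\<forall>i j. d i j \<noteq> 0 \<longrightarrow> i \<in> I \<and> j \<in> J \<and> x i j \<notin> \<int>) \<and>
    (\<forall>i\<in>I. (\<Sum>j\<in>J. d i j) = 0) \<and> (\<forall>j\<in>J. (\<Sum>i\<in>I. d i j) = 0)"
proof -
  define F where "F = {(i, j) \<in> I \<times> J. x i j \<notin> \<int>}"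
  have "F \<subseteq> I \<times> J" by (auto simp: F_def)
  have "finite F" using fin by (auto simp: F_def intro: finite_subset[of _ "I \<times> J"])
  define R where "R = fst ` F"
  define C where "C = snd ` F"
  have "2 \<le> card {f\<in>F. fst f = i}" if "i \<in> R" for i
  proof -
    have "{f\<in>F. fst f = i} = Pair i ` {j\<in>J. x i j \<notin> \<int>}" "i \<in> I" "{j\<in>J. x i j \<notin> \<int>} \<noteq> {}"
      using that by (auto simp: F_def R_def)
    then show ?thesis
      using card_fractional_ge_2[of J "x i"] fin bounds rows by (simp add: card_image inj_on_def)
  qed
  then have R: "2 * card R \<le> card F"
    unfolding R_def using \<open>finite F\<close> by (intro card_ge_twice_card_image) auto
  have "2 \<le> card {f\<in>F. snd f = j}" if "j \<in> C" for j
  proof -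
    have "{f\<in>F. snd f = j} = (\<lambda>i. (i, j)) ` {i\<in>I. x i j \<notin> \<int>}" "j \<in> J" "{i\<in>I. x i j \<notin> \<int>} \<noteq> {}"
      using that by (auto simp: F_def C_def)
    then show ?thesis
      using card_fractional_ge_2[of I "\<lambda>i. x i j"] fin bounds cols by (simp add: card_image inj_on_def)
  qed
  then have C: "2 * card C \<le> card F"
    unfolding C_def using \<open>finite F\<close> by (intro card_ge_twice_card_image) auto
  have "i0 \<in> R" using frac by (force simp: R_def F_def)
  have finRC: "finite R" "finite C" using \<open>finite F\<close> by (auto simp: R_def C_def)
  \<comment> \<open>One row equation is redundant, because all row sums and all column sums have the same total.\<close>
  define E where "E = Inl ` (R - {i0}) \<union> Inr ` C"
  \<comment> \<open>\<open>a\<close> is the vertex-edge incidence matrix of the bipartite graph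
    whose vertices are rows and columns and whose edges are matrix positions.\<close>
  define a :: "'i + 'j \<Rightarrow> 'i \<times> 'j \<Rightarrow> real" where
    "a = (\<lambda>e f. of_bool (case e of Inl i \<Rightarrow> fst f = i | Inr j \<Rightarrow> snd f = j))"
  have "card E = card (R - {i0}) + card C"
    unfolding E_def using finRC by (subst card_Un_disjoint) (auto simp: card_image)
  moreover have "card (R - {i0}) < card R"
    using finRC \<open>i0 \<in> R\<close> by (rule_tac card_Diff1_less)
  ultimately have "card E < card F" using R C by linarith
  moreover have "finite E" using finRC by (auto simp: E_def)
  ultimately obtain d where d: "\<exists>f\<in>F. d f \<noteq> 0" "\<forall>e\<in>E. (\<Sum>f\<in>F. a e f * d f) = 0"
    using homogeneous_system_nontrivial_solution[of E F a] \<open>finite F\<close> by blast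
  define D where "D = (\<lambda>i j. if (i, j) \<in> F then d (i, j) else 0)"
  have D_F: "D i j \<noteq> 0 \<Longrightarrow> (i, j) \<in> F" for i j by (auto simp: D_def split: if_splits)
  \<comment> \<open>As \<open>D\<close> vanishes off \<open>F\<close>, sums over \<open>F\<close>
    are sums over the whole matrix; the incidence coefficients then pick out one full row or column
    sum of \<open>D\<close>.\<close>
  have restrict: "(\<Sum>f\<in>F. w f * d f) = (\<Sum>i\<in>I. \<Sum>j\<in>J. w (i, j) * D i j)" for w
  proof -
    have "(\<Sum>f\<in>F. w f * d f) = (\<Sum>f\<in>I \<times> J. w f * D (fst f) (snd f))"
      using fin \<open>F \<subseteq> I \<times> J\<close> by (intro sum.mono_neutral_cong_left) (auto simp: D_def)
    then show ?thesis by (simp add: sum.cartesian_product split_def)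
  qed
  have row_eq: "(\<Sum>f\<in>F. a (Inl k) f * d f) = (\<Sum>j\<in>J. D k j)" if "k \<in> I" for k
  proof -
    have "(\<Sum>f\<in>F. a (Inl k) f * d f) = (\<Sum>i\<in>I. of_bool (i = k) * (\<Sum>j\<in>J. D i j))"
      unfolding restrict by (simp add: a_def sum_distrib_left)
    then show ?thesis using that fin by (simp add: of_bool_def if_distrib[of "\<lambda>b. b * _"] cong: if_cong)
  qed
  have col_eq: "(\<Sum>f\<in>F. a (Inr k) f * d f) = (\<Sum>i\<in>I. D i k)" if "k \<in> J" for k
  proof -
    have "(\<Sum>f\<in>F. a (Inr k) f * d f) = (\<Sum>i\<in>I. \<Sum>j\<in>J. of_bool (j = k) * D i j)"
      unfolding restrict by (simp add: a_def)
    then show ?thesis using that fin by (simp add: of_bool_def if_distrib[of "\<lambda>b. b * _"] cong: if_cong)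
  qed
  have col: "(\<Sum>i\<in>I. D i j) = 0" if "j \<in> J" for j
  proof (cases "j \<in> C")
    case True
    then show ?thesis using d(2) col_eq[OF that] by (auto simp: E_def)
  next
    case False
    then have "D i j = 0" for i using D_F[of i j] by (force simp: C_def)
    then show ?thesis by simp
  qed
  have row': "(\<Sum>j\<in>J. D i j) = 0" if "i \<in> I" "i \<noteq> i0" for i
  proof (cases "i \<in> R")
    case True
    then show ?thesis using d(2) row_eq[OF that(1)] that by (auto simp: E_def)
  next
    case False
    then have "D i j = 0" for j using D_F[of i j] by (force simp: R_def)
    then show ?thesis by simp
  qed
  \<comment> \<open>The omitted equation of row \<open>i0\<close> is recovered: the columns show
    that the whole matrix \<open>D\<close> sums to 0, and every other row contributes 0.\<close>
  have "(\<Sum>i\<in>I. \<Sum>j\<in>J. D i j) = 0" using col by (subst sum.swap) simp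
  moreover have "(\<Sum>i\<in>I. \<Sum>j\<in>J. D i j) = (\<Sum>j\<in>J. D i0 j)"
    using row' fin frac by (subst sum.remove[of I i0]) auto
  ultimately have "(\<Sum>j\<in>J. D i j) = 0" if "i \<in> I" for i
    using row'[OF that] by (cases "i = i0") auto
  moreover have "\<exists>i\<in>I. \<exists>j\<in>J. D i j \<noteq> 0"
    using d(1) \<open>F \<subseteq> I \<times> J\<close> by (fastforce simp: D_def)
  moreover have "\<forall>i j. D i j \<noteq> 0 \<longrightarrow> i \<in> I \<and> j \<in> J \<and> x i j \<notin> \<int>"
    using D_F by (auto simp: F_def)
  ultimately show ?thesis using col by (intro exI[of _ D]) blast
qed

section \<open>Rounding of matrices and assignments\<close>

text \<open>A ratio test as in the simplex method: stop at the first moment when a moving coordinate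
  reaches 0 or 1. The coordinate that attains the minimum becomes integral, and no other has left
  the cube by then.\<close>

lemma maximal_step_in_unit_cube:
  fixes h d :: "'a \<Rightarrow> real"
  assumes "finite A" and bounds: "\<And>a. a \<in> A \<Longrightarrow> 0 \<le> h a \<and> h a \<le> 1"
    and interior: "\<And>a. a \<in> A \<Longrightarrow> d a \<noteq> 0 \<Longrightarrow> h a \<notin> \<int>"
    and ne: "\<exists>a\<in>A. d a \<noteq> 0"
  shows "\<exists>t\<ge>0. (\<forall>a\<in>A. 0 \<le> h a + t * d a \<and> h a + t * d a \<le> 1) \<and>
    (\<exists>a\<in>A. d a \<noteq> 0 \<and> h a + t * d a \<in> \<int>)"
proof -
  \<comment> \<open>\<open>s a\<close> is the step length at which a moving coordinate reaches the
    face ahead of it, 1 if it grows and 0 if it shrinks. Coordinates at rest are excluded through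
    \<open>B\<close>.\<close>
  define s where "s = (\<lambda>a. if d a > 0 then (1 - h a) / d a else h a / (- d a))"
  define B where "B = {a\<in>A. d a \<noteq> 0}"
  have B: "finite (s ` B)" "s ` B \<noteq> {}" using assms by (auto simp: B_def)
  define t where "t = Min (s ` B)"
  have "t \<in> s ` B" unfolding t_def using B by (rule Min_in)
  then obtain b where b: "b \<in> A" "d b \<noteq> 0" "t = s b" by (auto simp: B_def)
  have "t \<ge> 0" using b bounds[of b] by (auto simp: s_def divide_nonneg_neg field_simps)
  have t_le: "t \<le> s a" if "a \<in> A" "d a \<noteq> 0" for a
    unfolding t_def using that B by (intro Min_le) (auto simp: B_def)
  have "0 \<le> h a + t * d a \<and> h a + t * d a \<le> 1" if a: "a \<in> A" for a
  proof (cases "d a" "0::real" rule: linorder_cases)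
    case less
    then have "t * - d a \<le> h a"
      using t_le[OF a] by (simp add: s_def field_simps)
    moreover have "t * d a \<le> 0" using less \<open>t \<ge> 0\<close> by (simp add: mult_nonneg_nonpos)
    ultimately show ?thesis using bounds[OF a] by auto
  next
    case greater
    then have "t * d a \<le> 1 - h a"
      using t_le[OF a] by (simp add: s_def field_simps)
    moreover have "t * d a \<ge> 0" using greater \<open>t \<ge> 0\<close> by simp
    ultimately show ?thesis using bounds[OF a] by auto
  qed (use bounds[OF a] in auto)
  moreover have "h b + t * d b \<in> {0, 1}" using b by (auto simp: s_def field_simps)
  then have "h b + t * d b \<in> \<int>" by auto
  ultimately show ?thesis using b \<open>t \<ge> 0\<close> by blast
qed

text \<open>Integrality of the transportation polytope with entries bounded by 1, by induction on
  the number of fractional entries. Leaving integral entries unchanged is part of the claim because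
  it later keeps forbidden allocations at 0.\<close>

lemma round_matrix_integral_sums:
  fixes x g :: "'i \<Rightarrow> 'j \<Rightarrow> real"
  assumes fin: "finite I" "finite J"
    and "\<And>i j. i \<in> I \<Longrightarrow> j \<in> J \<Longrightarrow> 0 \<le> x i j \<and> x i j \<le> 1"
    and "\<And>i. i \<in> I \<Longrightarrow> (\<Sum>j\<in>J. x i j) \<in> \<int>"
    and "\<And>j. j \<in> J \<Longrightarrow> (\<Sum>i\<in>I. x i j) \<in> \<int>"
  shows "\<exists>z. (\<forall>i\<in>I. \<forall>j\<in>J. z i j \<in> {0, 1} \<and> (x i j \<in> \<int> \<longrightarrow> z i j = x i j)) \<and>
    (\<forall>i\<in>I. (\<Sum>j\<in>J. z i j) = (\<Sum>j\<in>J. x i j)) \<and>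
    (\<forall>j\<in>J. (\<Sum>i\<in>I. z i j) = (\<Sum>i\<in>I. x i j)) \<and>
    (\<Sum>i\<in>I. \<Sum>j\<in>J. g i j * z i j) \<le> (\<Sum>i\<in>I. \<Sum>j\<in>J. g i j * x i j)"
  using assms(3-)
proof (induction "card {(i, j) \<in> I \<times> J. x i j \<notin> \<int>}" arbitrary: x rule: less_induct)
  case less
  note bounds = less.prems(1)
  show ?case
  proof (cases "\<exists>i\<in>I. \<exists>j\<in>J. x i j \<notin> \<int>")
    case False
    then have "x i j \<in> {0, 1}" if "i \<in> I" "j \<in> J" for i j
      using that bounds unit_interval_Ints_iff[of "x i j"] by auto
    then show ?thesis by (intro exI[of _ x]) auto
  next
    case True
    then obtain i0 j0 where "i0 \<in> I" "j0 \<in> J" "x i0 j0 \<notin> \<int>" by blast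
    from fractional_circulation[OF fin less.prems this]
    obtain d0 where d0: "\<exists>i\<in>I. \<exists>j\<in>J. d0 i j \<noteq> (0::real)"
      "\<And>i j. d0 i j \<noteq> 0 \<Longrightarrow> i \<in> I \<and> j \<in> J \<and> x i j \<notin> \<int>"
      "\<And>i. i \<in> I \<Longrightarrow> (\<Sum>j\<in>J. d0 i j) = 0" "\<And>j. j \<in> J \<Longrightarrow> (\<Sum>i\<in>I. d0 i j) = 0"
      by blast
    \<comment> \<open>The negative of a circulation is again one, so the sign can be chosen such
      that the cost does not increase.\<close>
    define \<sigma> :: real where "\<sigma> = (if (\<Sum>i\<in>I. \<Sum>j\<in>J. g i j * d0 i j) \<le> 0 then 1 else -1)"
    define d where "d = (\<lambda>i j. \<sigma> * d0 i j)"
    have "\<sigma> \<noteq> 0" by (simp add: \<sigma>_def)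
    then have d: "\<exists>i\<in>I. \<exists>j\<in>J. d i j \<noteq> 0"
      "\<And>i j. d i j \<noteq> 0 \<Longrightarrow> i \<in> I \<and> j \<in> J \<and> x i j \<notin> \<int>"
      "\<And>i. i \<in> I \<Longrightarrow> (\<Sum>j\<in>J. d i j) = 0" "\<And>j. j \<in> J \<Longrightarrow> (\<Sum>i\<in>I. d i j) = 0"
      unfolding d_def using d0 by (simp_all flip: sum_distrib_left)
    have "(\<Sum>i\<in>I. \<Sum>j\<in>J. g i j * d i j) = \<sigma> * (\<Sum>i\<in>I. \<Sum>j\<in>J. g i j * d0 i j)"
      by (simp add: d_def sum_distrib_left mult_ac)
    then have d_cost: "(\<Sum>i\<in>I. \<Sum>j\<in>J. g i j * d i j) \<le> 0"
      by (auto simp: \<sigma>_def)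
    have "\<exists>t\<ge>0. (\<forall>p\<in>I \<times> J. 0 \<le> x (fst p) (snd p) + t * d (fst p) (snd p) \<and>
        x (fst p) (snd p) + t * d (fst p) (snd p) \<le> 1) \<and>
      (\<exists>p\<in>I \<times> J. d (fst p) (snd p) \<noteq> 0 \<and> x (fst p) (snd p) + t * d (fst p) (snd p) \<in> \<int>)"
    proof (rule maximal_step_in_unit_cube)
      show "\<exists>p\<in>I \<times> J. d (fst p) (snd p) \<noteq> 0" using d(1) by force
    qed (use fin bounds d(2) in auto)
    then obtain t where t: "t \<ge> 0"
      "\<And>i j. i \<in> I \<Longrightarrow> j \<in> J \<Longrightarrow> 0 \<le> x i j + t * d i j \<and> x i j + t * d i j \<le> 1"
      "\<exists>i\<in>I. \<exists>j\<in>J. d i j \<noteq> 0 \<and> x i j + t * d i j \<in> \<int>"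
      unfolding Bex_def Ball_def mem_Times_iff split_paired_All split_paired_Ex fst_conv snd_conv
      by blast
    define w where "w = (\<lambda>i j. x i j + t * d i j)"
    have w_x: "w i j = x i j" if "x i j \<in> \<int>" for i j
      using that d(2)[of i j] by (auto simp: w_def)
    have w_rows: "(\<Sum>j\<in>J. w i j) = (\<Sum>j\<in>J. x i j)" if "i \<in> I" for i
      using d(3)[OF that] by (simp add: w_def sum.distrib flip: sum_distrib_left)
    have w_cols: "(\<Sum>i\<in>I. w i j) = (\<Sum>i\<in>I. x i j)" if "j \<in> J" for j
      using d(4)[OF that] by (simp add: w_def sum.distrib flip: sum_distrib_left)
    have "(\<Sum>i\<in>I. \<Sum>j\<in>J. g i j * w i j) =
        (\<Sum>i\<in>I. \<Sum>j\<in>J. g i j * x i j) + t * (\<Sum>i\<in>I. \<Sum>j\<in>J. g i j * d i j)"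
      by (simp add: w_def algebra_simps sum.distrib sum_distrib_left)
    then have w_cost: "(\<Sum>i\<in>I. \<Sum>j\<in>J. g i j * w i j) \<le> (\<Sum>i\<in>I. \<Sum>j\<in>J. g i j * x i j)"
      using t(1) d_cost by (simp add: mult_nonneg_nonpos)
    \<comment> \<open>\<open>d\<close> is supported on fractional entries of \<open>x\<close>, so
      the entry that the step made integral was fractional before. The induction measure therefore
      drops.\<close>
    obtain i1 j1 where "i1 \<in> I" "j1 \<in> J" "w i1 j1 \<in> \<int>" "x i1 j1 \<notin> \<int>"
      using t(3) d(2) unfolding w_def by blast
    then have "(i1, j1) \<in> {(i, j) \<in> I \<times> J. x i j \<notin> \<int>} - {(i, j) \<in> I \<times> J. w i j \<notin> \<int>}"
      by simp
    moreover have "{(i, j) \<in> I \<times> J. w i j \<notin> \<int>} \<subseteq> {(i, j) \<in> I \<times> J. x i j \<notin> \<int>}"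
      using w_x by auto
    ultimately have "{(i, j) \<in> I \<times> J. w i j \<notin> \<int>} \<subset> {(i, j) \<in> I \<times> J. x i j \<notin> \<int>}"
      by blast
    then have "card {(i, j) \<in> I \<times> J. w i j \<notin> \<int>} < card {(i, j) \<in> I \<times> J. x i j \<notin> \<int>}"
      using fin by (intro psubset_card_mono) (auto intro: finite_subset[of _ "I \<times> J"])
    moreover have "0 \<le> w i j \<and> w i j \<le> 1" if "i \<in> I" "j \<in> J" for i j
      using t(2)[OF that] by (simp add: w_def)
    moreover have "(\<Sum>j\<in>J. w i j) \<in> \<int>" if "i \<in> I" for i
      using less.prems(2) w_rows that by simp
    moreover have "(\<Sum>i\<in>I. w i j) \<in> \<int>" if "j \<in> J" for j
      using less.prems(3) w_cols that by simp
    ultimately obtain z where z: "\<forall>i\<in>I. \<forall>j\<in>J. z i j \<in> {0, 1} \<and> (w i j \<in> \<int> \<longrightarrow> z i j = w i j)"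
      "\<forall>i\<in>I. (\<Sum>j\<in>J. z i j) = (\<Sum>j\<in>J. w i j)" "\<forall>j\<in>J. (\<Sum>i\<in>I. z i j) = (\<Sum>i\<in>I. w i j)"
      "(\<Sum>i\<in>I. \<Sum>j\<in>J. g i j * z i j) \<le> (\<Sum>i\<in>I. \<Sum>j\<in>J. g i j * w i j)"
      using less.hyps[of w] by blast
    have "\<forall>i\<in>I. \<forall>j\<in>J. z i j \<in> {0, 1} \<and> (x i j \<in> \<int> \<longrightarrow> z i j = x i j)"
      using z(1) w_x by simp
    then show ?thesis
      using z(2-4) w_rows w_cols w_cost by (intro exI[of _ z]) auto
  qed
qed

text \<open>Column sums may be fractional here and can only be kept between floor and ceiling. This
  suffices for any integral bound on the number of customers at a plant.\<close>

lemma round_assignment: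
  fixes x g :: "'i \<Rightarrow> 'j \<Rightarrow> real"
  assumes fin: "finite I" "finite J"
    and bounds: "\<And>i j. i \<in> I \<Longrightarrow> j \<in> J \<Longrightarrow> 0 \<le> x i j \<and> x i j \<le> 1"
    and rows: "\<And>i. i \<in> I \<Longrightarrow> (\<Sum>j\<in>J. x i j) = 1"
  shows "\<exists>z. (\<forall>i\<in>I. \<forall>j\<in>J. z i j \<in> {0, 1} \<and> (x i j = 0 \<longrightarrow> z i j = 0)) \<and>
    (\<forall>i\<in>I. (\<Sum>j\<in>J. z i j) = 1) \<and>
    (\<forall>j\<in>J. of_int \<lfloor>\<Sum>i\<in>I. x i j\<rfloor> \<le> (\<Sum>i\<in>I. z i j) \<and> (\<Sum>i\<in>I. z i j) \<le> of_int \<lceil>\<Sum>i\<in>I. x i j\<rceil>) \<and>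
    (\<Sum>i\<in>I. \<Sum>j\<in>J. g i j * z i j) \<le> (\<Sum>i\<in>I. \<Sum>j\<in>J. g i j * x i j)"
proof -
  \<comment> \<open>A row of slacks makes all column sums integral; its own sum is then integral as well,
    since all other rows sum to 1.\<close>
  define S where "S = (\<lambda>j. \<Sum>i\<in>I. x i j)"
  define X where "X = (\<lambda>k j. case k of None \<Rightarrow> of_int \<lceil>S j\<rceil> - S j | Some i \<Rightarrow> x i j)"
  \<comment> \<open>Slacks cost nothing, so the cost bound for the extended matrix is one for
    \<open>x\<close> alone.\<close>
  define G where "G = (\<lambda>k j. case k of None \<Rightarrow> 0 | Some i \<Rightarrow> g i j)"
  define K where "K = insert None (Some ` I)"
  have sum_K: "(\<Sum>k\<in>K. h k) = h None + (\<Sum>i\<in>I. h (Some i))" for h :: "'i option \<Rightarrow> real"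
    using fin by (simp add: K_def sum.reindex)
  have "finite K" using fin by (simp add: K_def)
  moreover have "0 \<le> X k j \<and> X k j \<le> 1" if "k \<in> K" "j \<in> J" for k j
  proof (cases k)
    case None
    then show ?thesis using ceiling_correct[of "S j"] by (simp add: X_def)
  qed (use that bounds in \<open>auto simp: X_def K_def\<close>)
  moreover have X_col: "(\<Sum>k\<in>K. X k j) = of_int \<lceil>S j\<rceil>" for j
    by (simp add: sum_K X_def S_def)
  moreover have "(\<Sum>j\<in>J. X k j) \<in> \<int>" if "k \<in> K" for k
  proof (cases k)
    case None
    have "(\<Sum>j\<in>J. S j) = of_nat (card I)"
      unfolding S_def using rows by (subst sum.swap) simp
    moreover have "(\<Sum>j\<in>J. real_of_int \<lceil>S j\<rceil>) \<in> \<int>" by (intro Ints_sum) auto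
    ultimately show ?thesis using None by (simp add: X_def sum_subtractf)
  qed (use that rows in \<open>auto simp: X_def K_def\<close>)
  ultimately obtain Z where Z:
    "\<forall>k\<in>K. \<forall>j\<in>J. Z k j \<in> {0, 1} \<and> (X k j \<in> \<int> \<longrightarrow> Z k j = X k j)"
    "\<forall>k\<in>K. (\<Sum>j\<in>J. Z k j) = (\<Sum>j\<in>J. X k j)"
    "\<forall>j\<in>J. (\<Sum>k\<in>K. Z k j) = (\<Sum>k\<in>K. X k j)"
    "(\<Sum>k\<in>K. \<Sum>j\<in>J. G k j * Z k j) \<le> (\<Sum>k\<in>K. \<Sum>j\<in>J. G k j * X k j)"
    using round_matrix_integral_sums[of K J X G] fin by auto
  define z where "z = (\<lambda>i. Z (Some i))"
  have "of_int \<lfloor>S j\<rfloor> \<le> (\<Sum>i\<in>I. z i j) \<and> (\<Sum>i\<in>I. z i j) \<le> of_int \<lceil>S j\<rceil>" if j: "j \<in> J" for j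
  proof -
    have eq: "Z None j + (\<Sum>i\<in>I. z i j) = of_int \<lceil>S j\<rceil>"
      using Z(3) j X_col[of j] by (simp add: sum_K z_def)
    have None: "Z None j \<in> {0, 1}" "X None j \<in> \<int> \<longrightarrow> Z None j = X None j"
      using Z(1) j by (auto simp: K_def)
    \<comment> \<open>The rounded slack is 0 or 1, so the real rows add up to the ceiling or one
      less. The latter is the floor if \<open>S j\<close> is fractional; if \<open>S j\<close> is
      integral, the slack was 0 and has stayed 0.\<close>
    show ?thesis
    proof (cases "S j \<in> \<int>")
      case True
      then have "of_int \<lceil>S j\<rceil> = S j" "of_int \<lfloor>S j\<rfloor> = S j" by (auto elim: Ints_cases)
      moreover from this have "Z None j = 0" using None(2) True by (simp add: X_def)
      ultimately show ?thesis using eq by simp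
    next
      case False
      then have "\<lceil>S j\<rceil> = \<lfloor>S j\<rfloor> + 1" by (simp add: ceiling_altdef) (metis Ints_of_int)
      then show ?thesis using eq None(1) by auto
    qed
  qed
  moreover have "\<forall>i\<in>I. \<forall>j\<in>J. z i j \<in> {0, 1} \<and> (x i j = 0 \<longrightarrow> z i j = 0)"
    using Z(1) by (force simp: z_def K_def X_def)
  moreover have "\<forall>i\<in>I. (\<Sum>j\<in>J. z i j) = 1"
    using Z(2) rows by (simp add: z_def K_def X_def)
  moreover have "(\<Sum>i\<in>I. \<Sum>j\<in>J. g i j * z i j) \<le> (\<Sum>i\<in>I. \<Sum>j\<in>J. g i j * x i j)"
    using Z(4) by (simp add: sum_K G_def X_def z_def)
  ultimately show ?thesis unfolding S_def by blast
qed

section \<open>Rounding a solution of the relaxed model\<close>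

text \<open>An integer above \<open>s\<close> is also above its ceiling. Together with the dual for
  floors, this carries the two load constraints of a plant over to the rounded allocation.\<close>

lemma sum_le_Int_of_round:
  fixes s s' b :: real
  assumes "s' \<le> of_int \<lceil>s\<rceil>" "s \<le> b" "b \<in> \<int>"
  shows "s' \<le> b"
proof -
  obtain k where "b = of_int k" using assms(3) by (auto elim: Ints_cases)
  then show ?thesis using assms(1,2) by (smt (verit) ceiling_le of_int_le_iff)
qed

lemma Int_le_sum_of_round:
  fixes s s' b :: real
  assumes "of_int \<lfloor>s\<rfloor> \<le> s'" "b \<le> s" "b \<in> \<int>"
  shows "b \<le> s'"
proof -
  obtain k where "b = of_int k" using assms(3) by (auto elim: Ints_cases)
  then show ?thesis using assms(1,2) by (smt (verit) le_floor_iff of_int_le_iff)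
qed

text \<open>\<open>y\<close> and \<open>u\<close> are kept and only \<open>x\<close> is rounded.
  Constraints that bound a single \<open>x i j\<close> or the load of a plant survive because the
  bounds are integral; the preference constraint for open plants with spare capacity needs an
  argument of its own.\<close>

lemma relaxed_solution_rounding:
  fixes P :: "('i, 'j) cflcp"
  assumes fin: "finite (customers P)" "finite (plants P)"
    and s: "s \<in> relaxed_feasible P"
  shows "\<exists>s'\<in>model_feasible P. cost P s' \<le> cost P s"
proof -
  obtain y x u where yxu: "s = (y, x, u)" by (cases s)
  define I where "I = customers P"
  define J where "J = plants P"
  have lin: "linear_constraints P (y, x, u)" and bin: "binary_yu P (y, x, u)"
    and bounds: "\<And>i j. i \<in> I \<Longrightarrow> j \<in> J \<Longrightarrow> 0 \<le> x i j \<and> x i j \<le> 1"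
    using s by (auto simp: yxu relaxed_feasible_def I_def J_def)
  \<comment> \<open>For feasible binary \<open>u\<close>, \<open>U j\<close> tells whether
    \<open>j\<close> ever fills up and \<open>before j r\<close> whether it does so before rank
    \<open>r\<close>. What matters for the rounding is that these sums are integral.\<close>
  define U where "U = (\<lambda>j. \<Sum>r\<in>ranks P. u j r)"
  define before where "before = (\<lambda>j r. \<Sum>r'\<in>{1..<r}. u j r')"
  define preferred where "preferred = (\<lambda>i j r. \<Sum>j'\<in>{j'\<in>J. (j', j) \<in> pref P i}. u j' r)"
  define upto where "upto = (\<lambda>i j. {j'\<in>J. (j', j) \<in> pref P i \<or> j' = j})"
  note defs = I_def J_def U_def before_def preferred_def upto_def
  have rows: "\<And>i. i \<in> I \<Longrightarrow> (\<Sum>j\<in>J. x i j) = 1"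
    and x_le_y: "\<And>i j. i \<in> I \<Longrightarrow> j \<in> J \<Longrightarrow> x i j \<le> y j"
    and u_le_y: "\<forall>j\<in>J. U j \<le> y j"
    and u_first: "(\<Sum>j\<in>J. u j 1) \<le> 1"
    and u_chain: "\<forall>r\<in>ranks P. r > 1 \<longrightarrow> (\<Sum>j\<in>J. u j r) \<le> (\<Sum>j\<in>J. u j (r - 1))"
    and cap_upper: "\<And>j. j \<in> J \<Longrightarrow> (\<Sum>i\<in>I. x i j) \<le> (real (capacity P j) - 1) * y j + U j"
    and cap_lower: "\<And>j. j \<in> J \<Longrightarrow> real (capacity P j) * U j \<le> (\<Sum>i\<in>I. x i j)"
    and full: "\<And>i j r. i \<in> I \<Longrightarrow> j \<in> J \<Longrightarrow> r \<in> ranks P \<Longrightarrow> x i j + before j r + preferred i j r \<le> 1 + y j"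
    and open_nonfull: "\<And>i j. i \<in> I \<Longrightarrow> j \<in> J \<Longrightarrow> y j - U j \<le> (\<Sum>j'\<in>upto i j. x i j')"
    using lin by (simp_all add: linear_constraints_def defs)
  have y_int: "y j \<in> \<int>" if "j \<in> J" for j
  proof -
    have "y j = 0 \<or> y j = 1" using bin that by (simp add: binary_yu_def J_def)
    then show ?thesis by auto
  qed
  have u_int: "u j r \<in> \<int>" if "j \<in> J" "r \<in> ranks P" for j r
  proof -
    have "u j r = 0 \<or> u j r = 1" using bin that by (simp add: binary_yu_def J_def)
    then show ?thesis by auto
  qed
  have U_int: "U j \<in> \<int>" if "j \<in> J" for j
    unfolding U_def using u_int that by (intro Ints_sum) auto
  have before_int: "before j r \<in> \<int>" if "j \<in> J" "r \<in> ranks P" for j r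
    unfolding before_def using u_int that by (intro Ints_sum) (auto simp: ranks_def)
  have preferred_int: "preferred i j r \<in> \<int>" if "r \<in> ranks P" for i j r
    unfolding preferred_def using u_int that by (intro Ints_sum) auto
  have "\<exists>z. (\<forall>i\<in>I. \<forall>j\<in>J. z i j \<in> {0, 1} \<and> (x i j = 0 \<longrightarrow> z i j = 0)) \<and>
    (\<forall>i\<in>I. (\<Sum>j\<in>J. z i j) = 1) \<and>
    (\<forall>j\<in>J. of_int \<lfloor>\<Sum>i\<in>I. x i j\<rfloor> \<le> (\<Sum>i\<in>I. z i j) \<and> (\<Sum>i\<in>I. z i j) \<le> of_int \<lceil>\<Sum>i\<in>I. x i j\<rceil>) \<and>
    (\<Sum>i\<in>I. \<Sum>j\<in>J. alloc_cost P i j * z i j) \<le> (\<Sum>i\<in>I. \<Sum>j\<in>J. alloc_cost P i j * x i j)"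
    using bounds rows by (rule round_assignment[OF fin[folded I_def J_def]])
  then obtain z where z: "\<forall>i\<in>I. \<forall>j\<in>J. z i j \<in> {0, 1} \<and> (x i j = 0 \<longrightarrow> z i j = 0)"
      "\<forall>i\<in>I. (\<Sum>j\<in>J. z i j) = 1"
      "\<forall>j\<in>J. of_int \<lfloor>\<Sum>i\<in>I. x i j\<rfloor> \<le> (\<Sum>i\<in>I. z i j) \<and> (\<Sum>i\<in>I. z i j) \<le> of_int \<lceil>\<Sum>i\<in>I. x i j\<rceil>"
    and z_cost: "(\<Sum>i\<in>I. \<Sum>j\<in>J. alloc_cost P i j * z i j) \<le> (\<Sum>i\<in>I. \<Sum>j\<in>J. alloc_cost P i j * x i j)"
    by (elim exE conjE) (rule that)
  have z01: "z i j = 0 \<or> z i j = 1" if "i \<in> I" "j \<in> J" for i j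
    using z(1) that by simp
  have z0: "z i j = 0" if "i \<in> I" "j \<in> J" "x i j = 0" for i j
    using z(1) that by simp
  have z_rows: "(\<Sum>j\<in>J. z i j) = 1" if "i \<in> I" for i
    using z(2) that by simp
  have z_cols: "of_int \<lfloor>\<Sum>i\<in>I. x i j\<rfloor> \<le> (\<Sum>i\<in>I. z i j)"
      "(\<Sum>i\<in>I. z i j) \<le> of_int \<lceil>\<Sum>i\<in>I. x i j\<rceil>" if "j \<in> J" for j
    using z(3) that by simp_all
  \<comment> \<open>An integral bound below 1 on a nonnegative entry must be 0, so it forces
    \<open>x i j = 0\<close>, which rounding preserves. A bound of at least 1 holds for every 0-1
    entry.\<close>
  have z_le: "z i j \<le> b" if "i \<in> I" "j \<in> J" "x i j \<le> b" "b \<in> \<int>" for i j b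
  proof (cases "b < 1")
    case True
    obtain k where "b = of_int k" using \<open>b \<in> \<int>\<close> by (rule Ints_cases)
    then have "b \<le> 0" using True by auto
    then have "x i j = 0" "b = 0" using bounds[OF that(1,2)] that(3) by linarith+
    then show ?thesis using z0[OF that(1,2)] by simp
  next
    case False
    then show ?thesis using z01[OF that(1,2)] by auto
  qed
  \<comment> \<open>With all other terms moved to the right, this is an integral upper bound on a
    single entry.\<close>
  have "z i j + before j r + preferred i j r \<le> 1 + y j" if "i \<in> I" "j \<in> J" "r \<in> ranks P" for i j r
  proof -
    have "x i j \<le> 1 + y j - before j r - preferred i j r" using full[OF that] by linarith
    moreover have "1 + y j - before j r - preferred i j r \<in> \<int>"
      using that y_int before_int preferred_int by (intro Ints_diff Ints_add Ints_1)
    ultimately have "z i j \<le> 1 + y j - before j r - preferred i j r" by (rule z_le[OF that(1,2)])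
    then show ?thesis by linarith
  qed
  moreover have "y j - U j \<le> (\<Sum>j'\<in>upto i j. z i j')" if ij: "i \<in> I" "j \<in> J" for i j
  proof (cases "y j - U j \<le> 0")
    case True
    have "0 \<le> z i j'" if "j' \<in> J" for j' using z01[OF ij(1) that] by auto
    then have "0 \<le> (\<Sum>j'\<in>upto i j. z i j')" by (intro sum_nonneg) (simp add: upto_def)
    with True show ?thesis by linarith
  next
    \<comment> \<open>An open plant with spare capacity excludes all plants that the customer likes less,
      so the constraint only depends on the zero entries of the allocation.\<close>
    case False
    have sub: "upto i j \<subseteq> J" by (auto simp: upto_def)
    have "y j - U j \<in> \<int>" using y_int U_int ij by auto
    then obtain k where "y j - U j = of_int k" by (rule Ints_cases)
    with False have "1 \<le> y j - U j" by simp
    then have lb: "1 \<le> (\<Sum>j'\<in>upto i j. x i j')" using open_nonfull[OF ij] by linarith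
    have split: "(\<Sum>j'\<in>J. h j') = (\<Sum>j'\<in>J - upto i j. h j') + (\<Sum>j'\<in>upto i j. h j')"
      for h :: "'j \<Rightarrow> real"
      using sub fin by (simp add: sum.subset_diff J_def)
    have nonneg: "0 \<le> x i j'" if "j' \<in> J - upto i j" for j' using bounds ij that by auto
    have "0 \<le> (\<Sum>j'\<in>J - upto i j. x i j')" using nonneg by (rule sum_nonneg)
    then have "(\<Sum>j'\<in>J - upto i j. x i j') = 0" and ub: "(\<Sum>j'\<in>upto i j. x i j') \<le> 1"
      using rows[OF ij(1)] split[of "x i"] lb by linarith+
    then have "\<forall>j'\<in>J - upto i j. x i j' = 0"
      using nonneg fin by (subst (asm) sum_nonneg_eq_0_iff) (auto simp: J_def)
    then have "(\<Sum>j'\<in>J - upto i j. z i j') = 0" using z0 ij by (intro sum.neutral) blast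
    then have "(\<Sum>j'\<in>upto i j. z i j') = 1" using split[of "z i"] z_rows[OF ij(1)] by linarith
    then show ?thesis using open_nonfull[OF ij] ub by linarith
  qed
  moreover have "(\<Sum>i\<in>I. z i j) \<le> (real (capacity P j) - 1) * y j + U j" if "j \<in> J" for j
    by (rule sum_le_Int_of_round[OF z_cols(2)[OF that] cap_upper[OF that]])
      (intro Ints_add Ints_mult Ints_diff Ints_1 Ints_of_nat y_int[OF that] U_int[OF that])
  moreover have "real (capacity P j) * U j \<le> (\<Sum>i\<in>I. z i j)" if "j \<in> J" for j
    by (rule Int_le_sum_of_round[OF z_cols(1)[OF that] cap_lower[OF that]])
      (intro Ints_mult Ints_of_nat U_int[OF that])
  moreover have "z i j \<le> y j" if "i \<in> I" "j \<in> J" for i j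
    by (rule z_le[OF that x_le_y[OF that] y_int[OF that(2)]])
  ultimately have "linear_constraints P (y, z, u)"
    using z_rows u_le_y u_first u_chain
    unfolding linear_constraints_def prod.case defs by blast
  then have "(y, z, u) \<in> model_feasible P"
    using bin z01 by (simp add: model_feasible_def binary_yu_def I_def J_def)
  moreover have "cost P (y, z, u) \<le> cost P s"
    using z_cost by (simp add: cost_def yxu I_def J_def)
  ultimately show ?thesis by blast
qed

section \<open>Attained minima and equality of optimal values\<close>

lemma model_feasible_subset_relaxed: "model_feasible P \<subseteq> relaxed_feasible P"
  by (force simp: model_feasible_def relaxed_feasible_def)

text \<open>The feasible set need not be finite, as the functions are unconstrained off the index
  sets. The cost, however, sees only the 0-1 values of \<open>y\<close> and \<open>x\<close> on
  these sets, so it takes finitely many values and its minimum is attained.\<close>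

lemma finite_cost_model_feasible:
  assumes fin: "finite (customers P)" "finite (plants P)"
  shows "finite (cost P ` model_feasible P)"
proof -
  \<comment> \<open>The characteristic functions of \<open>Y\<close> and \<open>X\<close> replace
    \<open>y\<close> and \<open>x\<close>; the 0 for \<open>u\<close> is an arbitrary default, since
    \<open>u\<close> does not enter the cost.\<close>
  define c where "c = (\<lambda>(Y, X). cost P (\<lambda>j. of_bool (j \<in> Y), \<lambda>i j. of_bool ((i, j) \<in> X), \<lambda>_ _. 0))"
  have "cost P (y, x, u) \<in> c ` (Pow (plants P) \<times> Pow (customers P \<times> plants P))"
    if "(y, x, u) \<in> model_feasible P" for y x u
  proof (rule image_eqI)
    have y: "y j = of_bool (y j = 1)" if "j \<in> plants P" for j
      using that \<open>_ \<in> model_feasible P\<close> by (auto simp: model_feasible_def binary_yu_def)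
    have x: "x i j = of_bool (x i j = 1)" if "i \<in> customers P" "j \<in> plants P" for i j
      using that \<open>_ \<in> model_feasible P\<close> by (auto simp: model_feasible_def)
    show "cost P (y, x, u) =
        c ({j\<in>plants P. y j = 1}, {(i, j) \<in> customers P \<times> plants P. x i j = 1})"
      unfolding c_def cost_def prod.case
      by (intro arg_cong2[of _ _ _ _ "(+)"] sum.cong refl) (auto simp: y[symmetric] x[symmetric])
  qed auto
  then have "cost P ` model_feasible P \<subseteq> c ` (Pow (plants P) \<times> Pow (customers P \<times> plants P))"
    by auto
  then show ?thesis using fin by (elim finite_subset) simp
qed

theorem proposition8:
  fixes P :: "('i, 'j) cflcp"
  assumes "cflcp_instance P"
  shows "(relaxed_feasible P \<noteq> {} \<longleftrightarrow> model_feasible P \<noteq> {}) \<and>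
    (model_feasible P \<noteq> {} \<longrightarrow>
      (\<exists>v. is_optimal_value (cost P) (model_feasible P) v \<and>
           is_optimal_value (cost P) (relaxed_feasible P) v))"
proof (intro conjI impI)
  have fin: "finite (customers P)" "finite (plants P)"
    using assms by (auto simp: cflcp_instance_def)
  note rounding = relaxed_solution_rounding[OF fin]
  show "relaxed_feasible P \<noteq> {} \<longleftrightarrow> model_feasible P \<noteq> {}"
    using rounding model_feasible_subset_relaxed[of P] by blast
  assume ne: "model_feasible P \<noteq> {}"
  define v where "v = Min (cost P ` model_feasible P)"
  have fin_cost: "finite (cost P ` model_feasible P)"
    using fin by (rule finite_cost_model_feasible)
  then have v_in: "v \<in> cost P ` model_feasible P"
    unfolding v_def using ne by (intro Min_in) auto
  have v_le: "v \<le> cost P s" if "s \<in> model_feasible P" for s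
    unfolding v_def using fin_cost that by (intro Min_le) auto
  \<comment> \<open>Rounding turns \<open>s\<close> into an integral solution of no greater cost, so
    the integral minimum bounds the relaxed costs as well.\<close>
  have "v \<le> cost P s" if "s \<in> relaxed_feasible P" for s
    using rounding[OF that] v_le by force
  then show "\<exists>v. is_optimal_value (cost P) (model_feasible P) v \<and>
      is_optimal_value (cost P) (relaxed_feasible P) v"
    using v_in v_le model_feasible_subset_relaxed[of P]
    unfolding is_optimal_value_def by (intro exI[of _ v]) blast
qed

end
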